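(* Let $m_0,d,n\ge 1$ be integers with $\gcd(m_0,d,n)=1$, let $m_1=m_0+d$, $m_2=m_0+2d$, and let $H=\langle m_0,m_1,m_2,n\rangle$ be the numerical semigroup generated by $m_0,m_1,m_2,n$. Assume that $\{m_0,m_1,m_2,n\}$ is a minimal generating set of $H$ and that $H$ is symmetric. Let $k$ be a field. Then the defining ideal $I(H)\subset k[x_0,x_1,x_2,x_3]$ of $k[H]$ has a minimal generating set consisting of $\mathrm{RF}$-relations.
   Context: Let $H$ be a numerical semigroup minimally generated by $a_0,\dots,a_e$ (here the generators are taken in the order $m_0,m_1,m_2,n$). A pseudo-Frobenius number of $H$ is an element $f\in\mathbb Z\setminus H$ with $f+h\in H$ for all $h\in H\setminus\{0\}$; the set of these is $\mathrm{PF}(H)$. $H$ is symmetric if $|\mathrm{PF}(H)|=1$. Defining ideal: for a field $k$, $k[H]=k[t^{a_0},\dots,t^{a_e}]\subset k[t]$, and $I(H)$ is the kernel of the $k$-algebra map $\pi:k[x_0,\dots,x_e]\to k[H]$, $\pi(x_i)=t^{a_i}$. RF-matrix: for $f\in\mathrm{PF}(H)$, an $\mathrm{RF}$-matrix for $f$, denoted $\mathrm{RF}(f)$, is a matrix $A=(a_{ij})_{0\le i,j\le e}$ with integer entries such that $a_{ii}=-1$ for all $i$, $a_{ij}\in\mathbb N=\{0,1,2,\dots\}$ for $i\ne j$, and $\sum_{j} a_{ij}a_j=f$ for every $i$ (where $a_j$ with a single index is the generator). It need not be unique. RF-relations: for $b\in\mathbb Z^{e+1}$ let $b^+$ be the vector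 with $i$-th entry $\max(b_i,0)$ and $b^-=b^+-b$. If $\delta_1,\dots,\delta_{e+1}$ are the rows of some $\mathrm{RF}$-matrix for $f\in\mathrm{PF}(H)$ and $\delta_{(ij)}=\delta_j-\delta_i$ for $i<j$, the binomial $\phi_{ij}=\mathbf x^{\delta_{(ij)}^+}-\mathbf x^{\delta_{(ij)}^-}\in I(H)$ is called an $\mathrm{RF}(f)$-relation. An $\mathrm{RF}$-relation is an $\mathrm{RF}(f)$-relation for some $f\in \mathrm{PF}(H)$ (and some $\mathrm{RF}$-matrix for $f$; different relations may come from different $\mathrm{RF}$-matrices). *)

theory Defs
  imports
    "HOL-Library.Poly_Mapping"
    "HOL-Library.Numeral_Type"
    "HOL-Computational_Algebra.Polynomial"
begin

text \<open>
  Generators are indexed by a finite linearly ordered type \<open>'i\<close> in place of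
  \<open>{0, ..., e}\<close>; for four generators this is the numeral type \<open>4\<close>, whose order is
  \<open>0 < 1 < 2 < 3\<close>.
\<close>

definition submonoid_nat :: "nat set \<Rightarrow> bool" where
  "submonoid_nat S \<longleftrightarrow> 0 \<in> S \<and> (\<forall>x\<in>S. \<forall>y\<in>S. x + y \<in> S)"

definition generated_semigroup :: "nat set \<Rightarrow> nat set" where
  "generated_semigroup B = submonoid_nat hull B"

text \<open>Injectivity says that the generators in the list are pairwise distinct.\<close>

definition minimally_generates :: "('i \<Rightarrow> nat) \<Rightarrow> nat set \<Rightarrow> bool" where
  "minimally_generates a H \<longleftrightarrow>
     inj a \<and> generated_semigroup (range a) = H \<and>
     (\<forall>B. B \<subset> range a \<longrightarrow> generated_semigroup B \<noteq> H)"

definition PF :: "nat set \<Rightarrow> int set" where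
  "PF H = {f. f \<notin> int ` H \<and> (\<forall>h\<in>H - {0}. f + int h \<in> int ` H)}"

definition symmetric_semigroup :: "nat set \<Rightarrow> bool" where
  "symmetric_semigroup H \<longleftrightarrow> card (PF H) = 1"

text \<open>
  The polynomial ring over \<open>'k\<close> in the variables \<open>x\<^sub>i\<close>, \<open>i :: 'i\<close>: finitely supported
  coefficient functions on exponent vectors, with the convolution product.
\<close>

type_synonym ('i, 'k) mvpoly = "('i \<Rightarrow>\<^sub>0 nat) \<Rightarrow>\<^sub>0 'k"

definition semigroup_hom :: "('i::finite \<Rightarrow> nat) \<Rightarrow> ('i, 'k::field) mvpoly \<Rightarrow> 'k poly" where
  "semigroup_hom a p =
     (\<Sum>m\<in>Poly_Mapping.keys p.
        Polynomial.smult (Poly_Mapping.lookup p m)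
          (\<Prod>i\<in>UNIV. Polynomial.monom 1 (a i) ^ Poly_Mapping.lookup m i))"

definition defining_ideal :: "('i::finite \<Rightarrow> nat) \<Rightarrow> ('i, 'k::field) mvpoly set" where
  "defining_ideal a = {p. semigroup_hom a p = 0}"

definition ideal_span :: "'r::comm_ring_1 set \<Rightarrow> 'r set" where
  "ideal_span G = module.span (*) G"

definition minimal_generating_set :: "'r::comm_ring_1 set \<Rightarrow> 'r set \<Rightarrow> bool" where
  "minimal_generating_set G I \<longleftrightarrow>
     ideal_span G = I \<and> (\<forall>G'. G' \<subset> G \<longrightarrow> ideal_span G' \<noteq> I)"

definition RF_matrix :: "('i::finite \<Rightarrow> nat) \<Rightarrow> int \<Rightarrow> ('i \<Rightarrow> 'i \<Rightarrow> int) \<Rightarrow> bool" where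
  "RF_matrix a f A \<longleftrightarrow>
     (\<forall>i. A i i = -1) \<and>
     (\<forall>i j. i \<noteq> j \<longrightarrow> 0 \<le> A i j) \<and>
     (\<forall>i. (\<Sum>j\<in>UNIV. A i j * int (a j)) = f)"

definition pos_vec :: "('i \<Rightarrow> int) \<Rightarrow> 'i \<Rightarrow> int" where
  "pos_vec b = (\<lambda>i. max (b i) 0)"

definition neg_vec :: "('i \<Rightarrow> int) \<Rightarrow> 'i \<Rightarrow> int" where
  "neg_vec b = (\<lambda>i. pos_vec b i - b i)"

text \<open>Only used for nonnegative exponent vectors \<open>c\<close>, on which \<open>nat\<close> is the identity.\<close>

definition x_pow :: "('i::finite \<Rightarrow> int) \<Rightarrow> ('i, 'k::field) mvpoly" where
  "x_pow c = Poly_Mapping.single (Poly_Mapping.Abs_poly_mapping (\<lambda>i. nat (c i))) 1"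

definition RF_relations_for ::
    "('i::{finite,linorder} \<Rightarrow> nat) \<Rightarrow> int \<Rightarrow> ('i, 'k::field) mvpoly set" where
  "RF_relations_for a f =
     {x_pow (pos_vec \<delta>) - x_pow (neg_vec \<delta>) | A i j \<delta>.
        RF_matrix a f A \<and> i < j \<and> \<delta> = (\<lambda>l. A j l - A i l)}"

definition RF_relations ::
    "('i::{finite,linorder} \<Rightarrow> nat) \<Rightarrow> ('i, 'k::field) mvpoly set" where
  "RF_relations a = (\<Union>f\<in>PF (generated_semigroup (range a)). RF_relations_for a f)"

text \<open>
  The map \<open>semigroup_hom a\<close> is the \<open>'k\<close>-algebra homomorphism sending \<open>x\<^sub>i\<close> to \<open>t^(a i)\<close>,
  and \<open>ideal_span\<close> is an instance of the module span.
\<close>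

lemma semigroup_hom_superset:
  assumes "finite S" "Poly_Mapping.keys p \<subseteq> S"
  shows "semigroup_hom a p =
    (\<Sum>m\<in>S. Polynomial.smult (Poly_Mapping.lookup p m)
          (\<Prod>i\<in>UNIV. Polynomial.monom 1 (a i) ^ Poly_Mapping.lookup m i))"
  unfolding semigroup_hom_def
  by (rule sum.mono_neutral_left) (use assms in \<open>auto simp: in_keys_iff\<close>)

lemma semigroup_hom_add: "semigroup_hom a (p + q) = semigroup_hom a p + semigroup_hom a q"
proof -
  let ?S = "Poly_Mapping.keys p \<union> Poly_Mapping.keys q"
  have "Poly_Mapping.keys (p + q) \<subseteq> ?S"
    by (rule Poly_Mapping.keys_add)
  then show ?thesis
    by (simp add: semigroup_hom_superset[of ?S] lookup_add smult_add_left sum.distrib)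
qed

lemma semigroup_hom_single:
  "semigroup_hom a (Poly_Mapping.single m c) =
     Polynomial.smult c (\<Prod>i\<in>UNIV. Polynomial.monom 1 (a i) ^ Poly_Mapping.lookup m i)"
  by (subst semigroup_hom_superset[of "{m}"]) auto

lemma semigroup_hom_const: "semigroup_hom a (Poly_Mapping.single 0 c) = [:c:]"
  by (simp add: semigroup_hom_single)

lemma semigroup_hom_var:
  fixes a :: "'i::finite \<Rightarrow> nat"
  shows "semigroup_hom a (Poly_Mapping.single (Poly_Mapping.single i 1) 1) =
    (Polynomial.monom 1 (a i) :: 'k::field poly)"
proof -
  have "(\<Prod>j\<in>UNIV. Polynomial.monom 1 (a j) ^ Poly_Mapping.lookup (Poly_Mapping.single i 1) j)
      = (\<Prod>j\<in>UNIV. if j = i then Polynomial.monom 1 (a j) else (1 :: 'k poly))"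
    by (rule prod.cong) (auto simp: lookup_single)
  then show ?thesis
    by (simp add: semigroup_hom_single)
qed

lemma semigroup_hom_mult:
  fixes p q :: "('i::finite, 'k::field) mvpoly"
  shows "semigroup_hom a (p * q) = semigroup_hom a p * semigroup_hom a q"
proof -
  have single: "semigroup_hom a (Poly_Mapping.single m c * Poly_Mapping.single m' c') =
    semigroup_hom a (Poly_Mapping.single m c) * semigroup_hom a (Poly_Mapping.single m' c')"
    for m m' and c c' :: 'k
    by (simp add: mult_single semigroup_hom_single lookup_add power_add prod.distrib mult_ac)
  have zero: "semigroup_hom a (0 :: ('i, 'k) mvpoly) = 0"
    by (simp add: semigroup_hom_def)
  have sum: "semigroup_hom a (\<Sum>x\<in>X. F x) = (\<Sum>x\<in>X. semigroup_hom a (F x))"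
    for X :: "('i \<Rightarrow>\<^sub>0 nat) set" and F :: "_ \<Rightarrow> ('i, 'k) mvpoly"
    by (induction X rule: infinite_finite_induct) (simp_all add: zero semigroup_hom_add)
  have expand: "r = (\<Sum>m\<in>Poly_Mapping.keys r. Poly_Mapping.single m (Poly_Mapping.lookup r m))"
    for r :: "('i, 'k) mvpoly"
    by (rule poly_mapping_eqI)
      (auto simp: lookup_sum lookup_single when_def in_keys_iff sum.delta)
  have "semigroup_hom a (p * q) = semigroup_hom a
      ((\<Sum>m\<in>Poly_Mapping.keys p. Poly_Mapping.single m (Poly_Mapping.lookup p m)) *
       (\<Sum>m\<in>Poly_Mapping.keys q. Poly_Mapping.single m (Poly_Mapping.lookup q m)))"
    using expand[of p] expand[of q] by simp
  also have "\<dots> = semigroup_hom a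
      (\<Sum>m\<in>Poly_Mapping.keys p. Poly_Mapping.single m (Poly_Mapping.lookup p m)) *
     semigroup_hom a
      (\<Sum>m\<in>Poly_Mapping.keys q. Poly_Mapping.single m (Poly_Mapping.lookup q m))"
    by (simp only: sum_product sum single)
  finally show ?thesis
    using expand[of p] expand[of q] by simp
qed

lemma module_times: "module ((*) :: 'r::comm_ring_1 \<Rightarrow> 'r \<Rightarrow> 'r)"
  by unfold_locales (simp_all add: algebra_simps)

end

theory Submission
  imports Defs
begin

text \<open>
  Let \<open>f\<close> be the Frobenius number of a symmetric semigroup \<open>H\<close>, and let \<open>x\<^sup>u - x\<^sup>v\<close> be a binomial
  of weight \<open>b\<close> whose two monomials lie in different components of the graph that joins two
  factorizations of \<open>b\<close> whenever they share a generator. If \<open>i\<close> occurs in \<open>u\<close> and \<open>j\<close> occurs in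
  \<open>v\<close>, then \<open>b - a\<^sub>i - a\<^sub>j\<close> is not in \<open>H\<close>, since a factorization of it would give one of \<open>b\<close> adjacent
  to both \<open>u\<close> and \<open>v\<close>. By symmetry \<open>f + a\<^sub>i + a\<^sub>j - b\<close> has a factorization \<open>c\<close>, and the rows
  \<open>u + c - e\<^sub>i - e\<^sub>j\<close> (for \<open>j\<close>) and \<open>v + c - e\<^sub>i - e\<^sub>j\<close> (for \<open>i\<close>) of an RF-matrix for \<open>f\<close> have
  difference \<open>u - v\<close>. Joining one base component to every other one, in each weight \<open>b\<close>, gives a
  minimal generating set; taking \<open>i\<close> to be the least index that occurs in weight \<open>b\<close> settles the
  sign.
\<close>

abbreviation "lookup \<equiv> Poly_Mapping.lookup"
abbreviation "keys \<equiv> Poly_Mapping.keys"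
abbreviation "single \<equiv> Poly_Mapping.single"

section \<open>Factorizations\<close>

text \<open>The exponent of \<open>t\<close> in the image of the monomial with exponent vector
  \<open>m\<close>. Exponent vectors of weight \<open>b\<close> are the factorizations of
  \<open>b\<close>.\<close>

definition weight :: "('i::finite \<Rightarrow> nat) \<Rightarrow> ('i \<Rightarrow>\<^sub>0 nat) \<Rightarrow> nat" where
  "weight a m = (\<Sum>i\<in>UNIV. lookup m i * a i)"

lemma weight_zero [simp]: "weight a 0 = 0"
  by (simp add: weight_def)

lemma weight_add [simp]: "weight a (m + m') = weight a m + weight a m'"
  by (simp add: weight_def lookup_add distrib_right sum.distrib)

lemma weight_single [simp]: "weight a (single i k) = k * a i"
  by (simp add: weight_def lookup_single when_def if_distrib[of "\<lambda>x. x * _"] cong: if_cong)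

lemma lookup_pos_imp_split:
  fixes m :: "'i \<Rightarrow>\<^sub>0 nat"
  assumes "lookup m i > 0"
  obtains p where "m = single i 1 + p"
proof
  show "m = single i 1 + (m - single i 1)"
    by (rule poly_mapping_eqI) (use assms in \<open>auto simp: lookup_add lookup_minus lookup_single when_def\<close>)
qed

lemma weight_eq_0_imp:
  assumes "\<And>i. a i > 0" "weight a m = 0"
  shows "m = 0"
  using assms by (intro poly_mapping_eqI) (simp add: weight_def, metis less_irrefl)

section \<open>Generated semigroups as sets of weights\<close>

lemma submonoid_nat_generated: "submonoid_nat (generated_semigroup B)"
  unfolding generated_semigroup_def hull_def submonoid_nat_def by auto

lemma generated_semigroup_superset: "B \<subseteq> generated_semigroup B"
  unfolding generated_semigroup_def by (rule hull_subset)

lemma generated_semigroup_minimal: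
  "B \<subseteq> S \<Longrightarrow> submonoid_nat S \<Longrightarrow> generated_semigroup B \<subseteq> S"
  unfolding generated_semigroup_def by (rule hull_minimal)

lemma submonoid_nat_mult: "submonoid_nat S \<Longrightarrow> x \<in> S \<Longrightarrow> k * x \<in> S"
  by (induction k) (auto simp: submonoid_nat_def)

lemma submonoid_nat_sum:
  assumes "submonoid_nat S" "\<And>i. i \<in> A \<Longrightarrow> g i \<in> S"
  shows "sum g A \<in> S"
  using assms(2) by (induction A rule: infinite_finite_induct)
    (use assms(1) in \<open>auto simp: submonoid_nat_def\<close>)

lemma generated_semigroup_range: "generated_semigroup (range a) = range (weight a)"
proof (intro antisym generated_semigroup_minimal)
  show "range a \<subseteq> range (weight a)"
    using weight_single[of a _ 1] by (metis image_subset_iff mult_1 rangeI)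
  show "submonoid_nat (range (weight a))"
    unfolding submonoid_nat_def by (metis rangeE rangeI weight_add weight_zero)
  have "weight a m \<in> generated_semigroup (range a)" for m
    unfolding weight_def
    using generated_semigroup_superset[of "range a"]
    by (intro submonoid_nat_sum submonoid_nat_mult submonoid_nat_generated) auto
  then show "range (weight a) \<subseteq> generated_semigroup (range a)"
    by auto
qed

text \<open>Every submonoid contains 0, so dropping a zero generator would not change the semigroup,
  against minimality.\<close>

lemma minimally_generates_pos:
  assumes "minimally_generates a H"
  shows "a i > 0"
proof (rule ccontr)
  assume "\<not> a i > 0"
  then have "0 \<in> range a"
    by (metis gr0I rangeI)
  have "range a \<subseteq> generated_semigroup (range a - {0})"
    using generated_semigroup_superset[of "range a - {0}"]
      submonoid_nat_generated[of "range a - {0}"]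
    by (auto simp: submonoid_nat_def)
  then have "generated_semigroup (range a) \<subseteq> generated_semigroup (range a - {0})"
    by (rule generated_semigroup_minimal[OF _ submonoid_nat_generated])
  moreover have "generated_semigroup (range a - {0}) \<subseteq> generated_semigroup (range a)"
    using generated_semigroup_superset[of "range a"]
    by (intro generated_semigroup_minimal submonoid_nat_generated) auto
  ultimately show False
    using assms \<open>0 \<in> range a\<close> unfolding minimally_generates_def by blast
qed

section \<open>Symmetric semigroups\<close>

text \<open>Write \<open>x = q * h + r\<close> with \<open>r < h\<close>. Once
  \<open>x \<ge> h * h\<close>, also \<open>r < q\<close>, and
  \<open>x = (q - r) * h + r * Suc h\<close>.\<close>

lemma finite_gaps_if_consecutive:
  assumes S: "submonoid_nat S" and h: "h \<in> S" "Suc h \<in> S"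
  shows "finite (- S)"
proof (cases "h = 0")
  case True
  then have "x \<in> S" for x
    using submonoid_nat_mult[OF S h(2), of x] by simp
  then show ?thesis
    by (simp add: Compl_eq_Diff_UNIV UNIV_eq_I[of S])
next
  case False
  have "x \<in> S" if "x \<ge> h * h" for x
  proof -
    have "x mod h < h" "h \<le> x div h"
      using False that div_le_mono[of "h * h" x h] by auto
    then have "(x div h - x mod h) * h + (x mod h) * Suc h = x div h * h + x mod h"
      by (auto simp: algebra_simps diff_mult_distrib2)
    then have "x = (x div h - x mod h) * h + (x mod h) * Suc h"
      by simp
    moreover have "(x div h - x mod h) * h + (x mod h) * Suc h \<in> S"
      using submonoid_nat_mult[OF S h(1)] submonoid_nat_mult[OF S h(2)] S
      unfolding submonoid_nat_def by blast
    ultimately show ?thesis by simp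
  qed
  then have "- S \<subseteq> {..<h * h}"
    using not_less by auto
  then show ?thesis
    using finite_subset by blast
qed

lemma bezout_3:
  fixes x y z :: nat
  assumes "gcd x (gcd y z) = 1"
  obtains r s t :: int where "r * int x + s * int y + t * int z = 1"
proof -
  obtain p q where pq: "p * int y + q * int z = gcd (int y) (int z)"
    using bezout_int[of "int y" "int z"] by auto
  obtain r s where "r * int x + s * gcd (int y) (int z) = gcd (int x) (gcd (int y) (int z))"
    using bezout_int[of "int x" "gcd (int y) (int z)"] by auto
  also have "\<dots> = 1"
    using assms by (simp add: gcd_int_int_eq)
  finally have "r * int x + (s * p) * int y + (s * q) * int z = 1"
    by (simp only: pq[symmetric] distrib_left mult.assoc add.assoc)
  then show thesis
    by (rule that)
qed

lemma finite_gaps_if_coprime: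
  assumes S: "submonoid_nat S" "x \<in> S" "y \<in> S" "z \<in> S" and "gcd x (gcd y z) = 1"
  shows "finite (- S)"
proof -
  obtain r s t where "r * int x + s * int y + t * int z = 1"
    using bezout_3[OF assms(5)] .
  \<comment> \<open>Splitting each Bezout coefficient into positive and negative parts and moving
    the negative ones across yields two consecutive elements of \<open>S\<close>.\<close>
  moreover have "k * l = int (nat k) * l - int (nat (- k)) * l" for k l
    by (cases "k \<ge> 0") auto
  note this[of r "int x"] this[of s "int y"] this[of t "int z"]
  ultimately have "int (nat r) * int x + int (nat s) * int y + int (nat t) * int z =
      int (nat (- r)) * int x + int (nat (- s)) * int y + int (nat (- t)) * int z + 1"
    by linarith
  then have *: "nat r * x + nat s * y + nat t * z =
      Suc (nat (- r) * x + nat (- s) * y + nat (- t) * z)"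
    unfolding of_nat_eq_iff[where 'a = int, symmetric] of_nat_add of_nat_mult of_nat_Suc
    by linarith
  have comb: "k * x + l * y + n * z \<in> S" for k l n
    using submonoid_nat_mult[OF S(1)] S by (simp add: submonoid_nat_def)
  have "Suc (nat (- r) * x + nat (- s) * y + nat (- t) * z) \<in> S"
    using comb[of "nat r" "nat s" "nat t"] by (simp only: *)
  then show ?thesis
    by (rule finite_gaps_if_consecutive[OF S(1) comb])
qed

text \<open>Among the translates of \<open>x\<close> by elements of \<open>H\<close> that still miss
  \<open>H\<close>, the largest is pseudo-Frobenius: any further positive shift from
  \<open>H\<close> must land in \<open>H\<close>.\<close>

lemma PF_above_gap:
  assumes H: "submonoid_nat H" and fin: "finite (- H)" and x: "x \<notin> int ` H"
  obtains h where "h \<in> H" "x + int h \<in> PF H"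
proof -
  let ?A = "{h \<in> H. x + int h \<notin> int ` H}"
  \<comment> \<open>Either \<open>x + h\<close> is negative, which bounds \<open>h\<close>, or it is
    one of the finitely many gaps.\<close>
  have "?A \<subseteq> {..nat (- x)} \<union> (\<lambda>g. nat (int g - x)) ` (- H)"
  proof
    fix h assume h: "h \<in> ?A"
    show "h \<in> {..nat (- x)} \<union> (\<lambda>g. nat (int g - x)) ` (- H)"
    proof (cases "x + int h < 0")
      case False
      then have "nat (x + int h) \<in> - H" "h = nat (int (nat (x + int h)) - x)"
        using h by (auto simp: image_iff)
      then show ?thesis by blast
    qed auto
  qed
  then have finA: "finite ?A"
    using fin finite_subset by blast
  have "0 \<in> ?A"
    using H x by (simp add: submonoid_nat_def)
  then have "Max ?A \<in> ?A"
    using finA Max_in by blast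
  then have M: "Max ?A \<in> H" "x + int (Max ?A) \<notin> int ` H"
    by auto
  have "x + int (Max ?A) + int h \<in> int ` H" if "h \<in> H - {0}" for h
  proof (rule ccontr)
    assume "x + int (Max ?A) + int h \<notin> int ` H"
    then have "Max ?A + h \<in> ?A"
      using M that H by (auto simp: submonoid_nat_def add.assoc)
    then show False
      using Max_ge[OF finA, of "Max ?A + h"] that by simp
  qed
  then show thesis
    using M that[of "Max ?A"] by (auto simp: PF_def)
qed

text \<open>The pseudo-Frobenius number above \<open>x\<close> can only be \<open>f\<close>, so
  \<open>f\<close> is \<open>x\<close> plus an element of \<open>H\<close>.\<close>

lemma symmetric_reflect:
  assumes "submonoid_nat H" "finite (- H)" "PF H = {f}" "x \<notin> int ` H"
  shows "f - x \<in> int ` H"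
proof -
  obtain h where "h \<in> H" "x + int h \<in> PF H"
    using PF_above_gap assms by blast
  then have "f - x = int h"
    using assms(3) by simp
  then show ?thesis
    using \<open>h \<in> H\<close> by blast
qed

section \<open>Linear functionals on polynomials\<close>

text \<open>Used for two kinds of \<open>C\<close>: weight classes, which detect membership in the
  defining ideal, and connected components, which separate one generator from the others.\<close>

definition coeff_sum :: "('i \<Rightarrow>\<^sub>0 nat) set \<Rightarrow> ('i, 'k::field) mvpoly \<Rightarrow> 'k" where
  "coeff_sum C p = (\<Sum>m\<in>keys p. if m \<in> C then lookup p m else 0)"

lemma coeff_sum_add: "coeff_sum C (p + q) = coeff_sum C p + coeff_sum C q"
  unfolding coeff_sum_def by (rule setsum_keys_plus_distrib) auto

lemma coeff_sum_single [simp]: "coeff_sum C (single m c) = (if m \<in> C then c else 0)"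
  by (cases "c = 0") (auto simp: coeff_sum_def)

lemma coeff_sum_0 [simp]: "coeff_sum C 0 = 0"
  by (simp add: coeff_sum_def)

lemma coeff_sum_diff: "coeff_sum C (p - q) = coeff_sum C p - coeff_sum C q"
  using coeff_sum_add[of C "p - q" q] by simp

lemma coeff_sum_sum: "coeff_sum C (sum g A) = (\<Sum>x\<in>A. coeff_sum C (g x))"
  by (induction A rule: infinite_finite_induct) (auto simp: coeff_sum_add)

lemma mvpoly_expand:
  fixes p :: "('i, 'k::field) mvpoly"
  shows "p = (\<Sum>m\<in>keys p. single m (lookup p m))"
  by (rule poly_mapping_eqI) (auto simp: lookup_sum lookup_single when_def in_keys_iff)

lemma semigroup_hom_eq_sum_monom:
  fixes p :: "('i::finite, 'k::field) mvpoly"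
  shows "semigroup_hom a p = (\<Sum>m\<in>keys p. Polynomial.monom (lookup p m) (weight a m))"
proof -
  have "(\<Prod>i\<in>UNIV. Polynomial.monom 1 (a i) ^ lookup m i) =
      (Polynomial.monom 1 (weight a m) :: 'k poly)" for m
  proof -
    have "(\<Prod>i\<in>A. Polynomial.monom 1 (a i) ^ lookup m i) =
        (Polynomial.monom 1 (\<Sum>i\<in>A. lookup m i * a i) :: 'k poly)" for A
      by (induction A rule: infinite_finite_induct)
        (auto simp: monom_power mult_monom mult.commute)
    then show ?thesis
      by (simp add: weight_def)
  qed
  then show ?thesis
    by (simp add: semigroup_hom_def smult_monom)
qed

lemma coeff_semigroup_hom:
  "Polynomial.coeff (semigroup_hom a p) b = coeff_sum {m. weight a m = b} p"
  by (simp add: semigroup_hom_eq_sum_monom coeff_sum_def coeff_sum when_def)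

lemma in_defining_ideal_iff:
  "p \<in> defining_ideal a \<longleftrightarrow> (\<forall>b. coeff_sum {m. weight a m = b} p = 0)"
  by (auto simp: defining_ideal_def poly_eq_iff coeff_semigroup_hom)

section \<open>Ideals as submodules of the polynomial ring\<close>

interpretation mult: module "(*) :: 'r::comm_ring_1 \<Rightarrow> 'r \<Rightarrow> 'r"
  by (rule module_times)

lemma ideal_span_eq [simp]: "ideal_span G = mult.span G"
  by (simp add: ideal_span_def)

lemma subspace_defining_ideal:
  "mult.subspace (defining_ideal a :: ('i::finite, 'k::field) mvpoly set)"
  unfolding mult.subspace_def
  by (auto simp: defining_ideal_def semigroup_hom_add semigroup_hom_mult)
    (simp add: semigroup_hom_def)

text \<open>The functional is linear over the field but not over the polynomial ring. Monomial
  multiples of the generators span the ideal over the field, so testing those is enough.\<close>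

lemma coeff_sum_eq_0_on_span:
  fixes G :: "('i, 'k::field) mvpoly set"
  assumes "\<And>g q. g \<in> G \<Longrightarrow> coeff_sum C (single q 1 * g) = 0" and "p \<in> mult.span G"
  shows "coeff_sum C p = 0"
proof -
  \<comment> \<open>The largest ideal inside the kernel of the functional.\<close>
  let ?N = "{p. \<forall>r. coeff_sum C (r * p) = 0}"
  have scale: "coeff_sum C (single q c * g) = c * coeff_sum C (single q 1 * g)"
    for q c and g :: "('i, 'k) mvpoly"
  proof -
    have "coeff_sum C (single q c * g) =
        (\<Sum>m\<in>keys g. coeff_sum C (single q c * single m (lookup g m)))" for c :: 'k
      by (subst mvpoly_expand[of g]) (simp add: sum_distrib_left coeff_sum_sum)
    then show ?thesis
      by (simp add: mult_single sum_distrib_left if_distrib cong: if_cong)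
  qed
  have "coeff_sum C (r * g) = 0" if "g \<in> G" for r g
    by (subst mvpoly_expand[of r])
      (simp add: sum_distrib_right coeff_sum_sum scale[of _ "lookup r _"] assms(1)[OF that])
  then have "G \<subseteq> ?N"
    by auto
  moreover have "mult.subspace ?N"
    by (auto simp: mult.subspace_def distrib_left coeff_sum_add simp flip: mult.assoc)
  ultimately have "p \<in> ?N"
    using assms(2) mult.span_minimal by blast
  then have "coeff_sum C (1 * p) = 0"
    by blast
  then show ?thesis
    by simp
qed

section \<open>The graph of factorizations\<close>

text \<open>Reflexivity is a rule of its own because the zero factorization shares no generator with
  itself.\<close>

inductive connected_fact :: "('i::finite \<Rightarrow> nat) \<Rightarrow> ('i \<Rightarrow>\<^sub>0 nat) \<Rightarrow> ('i \<Rightarrow>\<^sub>0 nat) \<Rightarrow> bool"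
  for a where
  refl: "connected_fact a m m"
| step: "connected_fact a m m' \<Longrightarrow> weight a m' = weight a m'' \<Longrightarrow>
    lookup m' i > 0 \<Longrightarrow> lookup m'' i > 0 \<Longrightarrow> connected_fact a m m''"

lemma connected_fact_weight: "connected_fact a m m' \<Longrightarrow> weight a m = weight a m'"
  by (induction rule: connected_fact.induct) auto

lemma connected_fact_adjacent:
  "weight a m = weight a m' \<Longrightarrow> lookup m i > 0 \<Longrightarrow> lookup m' i > 0 \<Longrightarrow> connected_fact a m m'"
  by (blast intro: connected_fact.intros)

lemma connected_fact_trans:
  assumes "connected_fact a m' m''" "connected_fact a m m'"
  shows "connected_fact a m m''"
  using assms by (induction rule: connected_fact.induct) (auto intro: connected_fact.step)

lemma connected_fact_sym: "connected_fact a m m' \<Longrightarrow> connected_fact a m' m"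
proof (induction rule: connected_fact.induct)
  case (step m m' m'' i)
  then show ?case
    using connected_fact_trans connected_fact_adjacent by metis
qed (rule connected_fact.refl)

text \<open>The choice depends only on the component as a predicate, so connected factorizations get
  the very same representative.\<close>

definition component_rep :: "('i::finite \<Rightarrow> nat) \<Rightarrow> ('i \<Rightarrow>\<^sub>0 nat) \<Rightarrow> ('i \<Rightarrow>\<^sub>0 nat)" where
  "component_rep a m = (SOME m'. connected_fact a m m')"

lemma connected_component_rep: "connected_fact a m (component_rep a m)"
  unfolding component_rep_def by (rule someI) (rule connected_fact.refl)

lemma weight_component_rep [simp]: "weight a (component_rep a m) = weight a m"
  using connected_fact_weight[OF connected_component_rep] by metis

lemma component_rep_eq:
  assumes "connected_fact a m m'"
  shows "component_rep a m = component_rep a m'"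
proof -
  have "connected_fact a m = connected_fact a m'"
    using assms connected_fact_trans connected_fact_sym by blast
  then show ?thesis
    by (simp add: component_rep_def)
qed

text \<open>A factorization of \<open>b\<close> containing the least index that occurs in any
  factorization of \<open>b\<close>. Phrasing this without a minimum also covers \<open>b\<close>
  whose factorizations contain no index at all.\<close>

definition base_fact :: "('i::{finite,linorder} \<Rightarrow> nat) \<Rightarrow> nat \<Rightarrow> ('i \<Rightarrow>\<^sub>0 nat)" where
  "base_fact a b =
     (SOME m. weight a m = b \<and> (\<forall>m' j. weight a m' = b \<longrightarrow> lookup m' j > 0 \<longrightarrow>
        (\<exists>i\<le>j. lookup m i > 0)))"

lemma base_fact:
  fixes a :: "'i::{finite,linorder} \<Rightarrow> nat"
  shows weight_base_fact [simp]: "weight a (base_fact a (weight a m)) = weight a m"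
    and base_fact_least: "weight a m = b \<Longrightarrow> lookup m j > 0 \<Longrightarrow> \<exists>i\<le>j. lookup (base_fact a b) i > 0"
proof -
  let ?P = "\<lambda>b m. weight a m = b \<and> (\<forall>m' j. weight a m' = b \<longrightarrow> lookup m' j > 0 \<longrightarrow>
        (\<exists>i\<le>j. lookup m i > 0))"
  have ex: "\<exists>m. ?P b m" if "weight a m0 = b" for b m0
  proof (cases "{j. \<exists>m. weight a m = b \<and> lookup m j > 0} = {}")
    case True
    then show ?thesis
      using that by blast
  next
    case False
    define J where "J = {j. \<exists>m. weight a m = b \<and> lookup m j > 0}"
    have "Min J \<in> J" "\<And>j. j \<in> J \<Longrightarrow> Min J \<le> j"
      using False by (auto simp: J_def[symmetric])
    then show ?thesis
      unfolding J_def by blast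
  qed
  have P: "?P b (base_fact a b)" if "weight a m = b" for b m
    unfolding base_fact_def using ex[OF that] by (rule someI_ex)
  show "weight a (base_fact a (weight a m)) = weight a m"
    using P by blast
  show "\<exists>i\<le>j. lookup (base_fact a b) i > 0" if "weight a m = b" "lookup m j > 0"
    using P that by blast
qed

text \<open>A star in each weight, from the base component to every other one. Although indexed by
  \<open>m\<close>, a binomial depends only on the component of \<open>m\<close>, so each component
  contributes once.\<close>

definition component_binomials ::
    "('i::{finite,linorder} \<Rightarrow> nat) \<Rightarrow> ('i, 'k::field) mvpoly set" where
  "component_binomials a =
     {single (base_fact a (weight a m)) 1 - single (component_rep a m) 1 | m.
        \<not> connected_fact a (base_fact a (weight a m)) m}"

section \<open>Minimal generation\<close>

text \<open>Induction on the weight. Edges of the graph reduce to smaller weight, paths telescope,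
  and different components are linked through the base factorization.\<close>

lemma binomial_in_span:
  fixes a :: "'i::{finite,linorder} \<Rightarrow> nat"
  assumes pos: "\<And>i. a i > 0" and "weight a m = weight a m'"
  shows "single m 1 - single m' 1 \<in> mult.span (component_binomials a :: ('i, 'k::field) mvpoly set)"
  using assms(2)
proof (induction "weight a m" arbitrary: m m' rule: less_induct)
  case less
  let ?S = "mult.span (component_binomials a :: ('i, 'k) mvpoly set)"
  let ?e = "\<lambda>m. single m (1::'k)"
  \<comment> \<open>Cancelling the shared variable lowers the weight, since
    \<open>a i > 0\<close>.\<close>
  have adj: "?e u - ?e v \<in> ?S"
    if uv: "weight a u = weight a m" "weight a u = weight a v" "lookup u i > 0" "lookup v i > 0"
    for u v i
  proof -
    obtain p q where pq: "u = single i 1 + p" "v = single i 1 + q"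
      using uv lookup_pos_imp_split by metis
    then have "weight a p < weight a m" "weight a p = weight a q"
      using uv pos[of i] by auto
    then have "?e p - ?e q \<in> ?S"
      using less.hyps by blast
    then have "?e (single i 1) * (?e p - ?e q) \<in> ?S"
      by (rule mult.span_scale)
    then show ?thesis
      by (simp add: pq right_diff_distrib mult_single)
  qed
  have conn: "?e u - ?e v \<in> ?S" if "connected_fact a u v" "weight a u = weight a m" for u v
    using that
  proof (induction rule: connected_fact.induct)
    case (refl u)
    then show ?case
      by (simp add: mult.span_zero)
  next
    case (step u v w i)
    then have "weight a v = weight a m"
      by (metis connected_fact_weight)
    then have "?e u - ?e v + (?e v - ?e w) \<in> ?S"
      using step by (intro mult.span_add adj[of v w i]) auto
    then show ?case
      by simp
  qed
  \<comment> \<open>Outside the base component, go from the base to the representative by a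
    generator, then to \<open>u\<close> by a path.\<close>
  have to_base: "?e (base_fact a (weight a m)) - ?e u \<in> ?S" if u: "weight a u = weight a m" for u
  proof (cases "connected_fact a (base_fact a (weight a m)) u")
    case True
    then show ?thesis
      by (rule conn) simp
  next
    case False
    then have "?e (base_fact a (weight a m)) - ?e (component_rep a u) \<in> ?S"
      unfolding component_binomials_def u[symmetric] by (intro mult.span_base) blast
    moreover have "?e (component_rep a u) - ?e u \<in> ?S"
      by (rule conn) (simp_all add: connected_component_rep connected_fact_sym u)
    ultimately have "?e (base_fact a (weight a m)) - ?e (component_rep a u)
        + (?e (component_rep a u) - ?e u) \<in> ?S"
      by (rule mult.span_add)
    then show ?thesis
      by simp
  qed
  have "?e (base_fact a (weight a m)) - ?e m' - (?e (base_fact a (weight a m)) - ?e m) \<in> ?S"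
    by (intro mult.span_diff to_base) (simp_all add: less.prems)
  then show ?case
    by simp
qed

text \<open>For the harder inclusion, replace every monomial of \<open>p\<close> by the base
  factorization of its weight. This changes \<open>p\<close> only by an element of the span, and
  nothing remains.\<close>

lemma span_component_binomials:
  fixes a :: "'i::{finite,linorder} \<Rightarrow> nat"
  assumes pos: "\<And>i. a i > 0"
  shows "mult.span (component_binomials a) = (defining_ideal a :: ('i, 'k::field) mvpoly set)"
    (is "?S = _")
proof (intro antisym mult.span_minimal subspace_defining_ideal)
  show "component_binomials a \<subseteq> (defining_ideal a :: ('i, 'k) mvpoly set)"
    by (auto simp: component_binomials_def in_defining_ideal_iff coeff_sum_diff)
  show "defining_ideal a \<subseteq> ?S"
  proof
    fix p :: "('i, 'k) mvpoly"
    assume p: "p \<in> defining_ideal a"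
    let ?r = "\<lambda>m. base_fact a (weight a m)"
    have "single m c - single (?r m) c \<in> ?S" for m c
    proof -
      have "single 0 c * (single m 1 - single (?r m) 1) \<in> ?S"
        by (intro mult.span_scale binomial_in_span pos) simp
      then show ?thesis
        by (simp add: right_diff_distrib mult_single)
    qed
    then have "(\<Sum>m\<in>keys p. single m (lookup p m) - single (?r m) (lookup p m)) \<in> ?S"
      by (intro mult.span_sum)
    \<comment> \<open>Within one weight all terms collapse to a single monomial, whose coefficient
      vanishes because \<open>p\<close> is in the defining ideal.\<close>
    moreover have "(\<Sum>m\<in>keys p. single (?r m) (lookup p m)) = 0"
    proof -
      have "(\<Sum>m\<in>{m \<in> keys p. weight a m = b}. single (?r m) (lookup p m)) = 0" for b
      proof -
        have "(\<Sum>m\<in>{m \<in> keys p. weight a m = b}. lookup p m) = 0"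
          using p by (simp add: in_defining_ideal_iff coeff_sum_def sum.If_cases Int_def)
        moreover have "(\<Sum>m\<in>{m \<in> keys p. weight a m = b}. single (?r m) (lookup p m)) =
            single (base_fact a b) (\<Sum>m\<in>{m \<in> keys p. weight a m = b}. lookup p m)"
          by (rule poly_mapping_eqI) (auto simp: lookup_sum lookup_single when_def)
        ultimately show ?thesis
          by simp
      qed
      then show ?thesis
        by (simp add: sum.image_gen[of "keys p" _ "weight a"])
    qed
    ultimately show "p \<in> ?S"
      using mvpoly_expand[of p] by (simp add: sum_subtractf)
  qed
qed

text \<open>The coefficient sum over the component of \<open>m\<close> kills every monomial multiple
  of the other generators but takes the value \<open>-1\<close> on \<open>g\<close>.\<close>

lemma component_binomial_not_in_span:
  fixes a :: "'i::{finite,linorder} \<Rightarrow> nat" and g :: "('i, 'k::field) mvpoly"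
  assumes pos: "\<And>i. a i > 0" and g: "g \<in> component_binomials a"
  shows "g \<notin> mult.span (component_binomials a - {g})"
proof
  assume span: "g \<in> mult.span (component_binomials a - {g})"
  obtain m where m: "g = single (base_fact a (weight a m)) 1 - single (component_rep a m) 1"
      "\<not> connected_fact a (base_fact a (weight a m)) m"
    using g unfolding component_binomials_def by blast
  define C where "C = {u. connected_fact a m u}"
  have "coeff_sum C (single q 1 * h) = 0" if h: "h \<in> component_binomials a - {g}" for h q
  proof -
    obtain m' where m': "h = single (base_fact a (weight a m')) 1 - single (component_rep a m') 1"
        "\<not> connected_fact a (base_fact a (weight a m')) m'"
      using h unfolding component_binomials_def by blast
    let ?u = "base_fact a (weight a m')" and ?v = "component_rep a m'"
    have "q + ?u \<in> C \<longleftrightarrow> q + ?v \<in> C"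
    proof (cases "q = 0")
      case True
      \<comment> \<open>If it lay in \<open>C\<close>, its weight would be that of \<open>m\<close>,
        making it the base factorization that \<open>m\<close> is not connected to.\<close>
      have "?u \<notin> C"
        using m(2) unfolding C_def
        by (metis connected_fact_sym connected_fact_weight mem_Collect_eq weight_base_fact)
      moreover have "?v \<notin> C"
      proof
        assume "?v \<in> C"
        then have "connected_fact a m m'"
          unfolding C_def
          using connected_fact_sym[OF connected_component_rep, of a m'] connected_fact_trans by blast
        then have "component_rep a m = ?v" "weight a m = weight a m'"
          by (simp_all add: component_rep_eq connected_fact_weight)
        then have "h = g"
          by (simp add: m(1) m'(1))
        then show False
          using h by simp
      qed
      ultimately show ?thesis
        using True by simp
    next
      case False
      \<comment> \<open>A generator in \<open>q\<close> occurs in both monomials of the multiple, so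
        they lie in one component.\<close>
      then obtain i where "lookup q i > 0"
        by (metis gr0I lookup_zero poly_mapping_eqI)
      then have "connected_fact a (q + ?u) (q + ?v)"
        by (intro connected_fact_adjacent[of _ _ _ i]) (auto simp: lookup_add)
      then show ?thesis
        unfolding C_def using connected_fact_trans connected_fact_sym by blast
    qed
    then show ?thesis
      by (simp add: m'(1) right_diff_distrib mult_single coeff_sum_diff)
  qed
  then have "coeff_sum C g = 0"
    using span by (rule coeff_sum_eq_0_on_span)
  moreover have "base_fact a (weight a m) \<notin> C" "component_rep a m \<in> C"
    using m(2) connected_fact_sym connected_component_rep by (auto simp: C_def)
  ultimately show False
    by (simp add: m(1) coeff_sum_diff)
qed

lemma minimal_generating_set_component_binomials:
  fixes a :: "'i::{finite,linorder} \<Rightarrow> nat"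
  assumes pos: "\<And>i. a i > 0"
  shows "minimal_generating_set (component_binomials a)
    (defining_ideal a :: ('i, 'k::field) mvpoly set)"
  unfolding minimal_generating_set_def
proof (intro conjI allI impI)
  show "ideal_span (component_binomials a) = (defining_ideal a :: ('i, 'k) mvpoly set)"
    by (simp add: span_component_binomials pos)
  fix G' :: "('i, 'k) mvpoly set"
  assume "G' \<subset> component_binomials a"
  then obtain g where g: "g \<in> component_binomials a" "G' \<subseteq> component_binomials a - {g}"
    by blast
  then have "g \<notin> mult.span G'"
    using component_binomial_not_in_span[of a, OF pos] mult.span_mono by blast
  moreover have "g \<in> defining_ideal a"
    using g(1) mult.span_base span_component_binomials[of a, OF pos] by blast
  ultimately show "ideal_span G' \<noteq> defining_ideal a"
    by auto
qed

section \<open>RF-relations\<close>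

lemma x_pow_lookup: "x_pow (\<lambda>l. int (lookup m l)) = single m 1"
  by (simp add: x_pow_def lookup_inverse)

text \<open>Only rows \<open>i\<close> and \<open>j\<close> are prescribed; each remaining row comes
  from an arbitrary factorization of \<open>f + a l\<close>. With \<open>i < j\<close> the relation
  uses row \<open>j\<close> minus row \<open>i\<close>, which gives \<open>u - v\<close> rather than
  its negative.\<close>

lemma binomial_is_RF_relation:
  fixes a :: "'i::{finite,linorder} \<Rightarrow> nat"
  assumes pos: "\<And>i. a i > 0" and fin: "finite (- range (weight a))"
    and PF: "PF (range (weight a)) = {f}"
    and uv: "weight a u = weight a v" "\<not> connected_fact a u v"
    and ij: "i < j" "lookup u i > 0" "lookup v j > 0"
  shows "single u 1 - single v 1 \<in> (RF_relations a :: ('i, 'k::field) mvpoly set)"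
proof -
  let ?H = "range (weight a)" and ?b = "weight a u"
  have H: "submonoid_nat ?H"
    using submonoid_nat_generated[of "range a"] by (simp add: generated_semigroup_range)
  have f: "f \<notin> int ` ?H" "\<And>h. h \<in> ?H - {0} \<Longrightarrow> f + int h \<in> int ` ?H"
    using singletonI[of f, folded PF] by (auto simp: PF_def)
  \<comment> \<open>Disjoint supports make \<open>u\<close> and \<open>v\<close> exactly the
    positive and negative parts of \<open>u - v\<close>.\<close>
  have disj: "lookup u l = 0 \<or> lookup v l = 0" for l
    using uv connected_fact_adjacent by blast
  have "int ?b - int (a i) - int (a j) \<notin> int ` ?H"
  proof
    assume "int ?b - int (a i) - int (a j) \<in> int ` ?H"
    then obtain p where "int ?b - int (a i) - int (a j) = int (weight a p)"
      by blast
    then have w: "weight a (p + single i 1 + single j 1) = ?b"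
      by simp
    have "connected_fact a u (p + single i 1 + single j 1)"
      using w ij by (intro connected_fact_adjacent[of _ _ _ i]) (auto simp: lookup_add)
    moreover have "connected_fact a (p + single i 1 + single j 1) v"
      using w uv ij by (intro connected_fact_adjacent[of _ _ _ j]) (auto simp: lookup_add)
    ultimately show False
      using uv connected_fact_trans by blast
  qed
  then have "f - (int ?b - int (a i) - int (a j)) \<in> int ` ?H"
    by (rule symmetric_reflect[OF H fin PF])
  then obtain c where c: "f - (int ?b - int (a i) - int (a j)) = int (weight a c)"
    by blast
  obtain u' where u': "u = single i 1 + u'"
    using ij lookup_pos_imp_split by metis
  obtain v' where v': "v = single j 1 + v'"
    using ij lookup_pos_imp_split by metis
  have "\<exists>m. int (weight a m) = f + int (a l)" for l
  proof -
    have "a l \<in> ?H - {0}"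
      using pos[of l] weight_single[of a l 1] by (metis Diff_iff mult_1 less_irrefl rangeI singletonD)
    then show ?thesis
      using f(2) by (metis (no_types, lifting) imageE)
  qed
  then obtain w where w: "\<And>l. int (weight a (w l)) = f + int (a l)"
    by metis
  \<comment> \<open>Rows are held as factorizations of \<open>f + a l\<close>; the unit vector of
    the diagonal is subtracted in \<open>A\<close>.\<close>
  define w' where "w' = w(i := v' + c, j := u' + c)"
  have w': "int (weight a (w' l)) = f + int (a l)" for l
  proof -
    have "weight a u = a i + weight a u'" "weight a v = a j + weight a v'"
      by (simp_all add: u' v')
    then have "int (weight a (v' + c)) = f + int (a i)" "int (weight a (u' + c)) = f + int (a j)"
      using c uv(1) by simp_all
    then show ?thesis
      using w by (simp add: w'_def)
  qed
  define A where "A = (\<lambda>r l. int (lookup (w' r) l) - (if l = r then 1 else 0))"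
  \<comment> \<open>Were \<open>l\<close> to occur in a factorization of \<open>f + a l\<close>,
    cancelling it would put \<open>f\<close> in the semigroup. Hence the diagonal entries are
    exactly \<open>-1\<close>.\<close>
  have diag: "lookup (w' l) l = 0" for l
  proof (rule ccontr)
    assume "lookup (w' l) l \<noteq> 0"
    then obtain p where "w' l = single l 1 + p"
      by (auto elim: lookup_pos_imp_split)
    then have "f = int (weight a p)"
      using w'[of l] by simp
    then show False
      using f(1) by blast
  qed
  have "(\<Sum>l\<in>UNIV. A r l * int (a l)) = f" for r
  proof -
    have "(\<Sum>l\<in>UNIV. A r l * int (a l)) =
        int (weight a (w' r)) - (\<Sum>l\<in>UNIV. if l = r then int (a l) else 0)"
      unfolding A_def weight_def left_diff_distrib sum_subtractf
      by (simp add: if_distrib[of "\<lambda>x. x * _"] cong: if_cong)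
    then show ?thesis
      using w'[of r] by simp
  qed
  then have "RF_matrix a f A"
    unfolding RF_matrix_def by (auto simp: A_def diag)
  moreover define \<delta> where "\<delta> = (\<lambda>l. A j l - A i l)"
  ultimately have "x_pow (pos_vec \<delta>) - x_pow (neg_vec \<delta>) \<in> (RF_relations_for a f :: ('i, 'k) mvpoly set)"
    unfolding RF_relations_for_def using ij(1) by blast
  moreover have \<delta>: "\<delta> l = int (lookup u l) - int (lookup v l)" for l
    using ij(1) by (auto simp: \<delta>_def A_def w'_def u' v' lookup_add lookup_single when_def)
  have "pos_vec \<delta> = (\<lambda>l. int (lookup u l))"
  proof
    show "pos_vec \<delta> l = int (lookup u l)" for l
      using disj[of l] by (auto simp: pos_vec_def \<delta>)
  qed
  moreover from this have "neg_vec \<delta> = (\<lambda>l. int (lookup v l))"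
    by (simp add: neg_vec_def \<delta>)
  ultimately have "single u 1 - single v 1 \<in> (RF_relations_for a f :: ('i, 'k) mvpoly set)"
    by (simp add: x_pow_lookup)
  then show ?thesis
    by (simp add: RF_relations_def generated_semigroup_range PF)
qed

lemma component_binomials_subset_RF_relations:
  fixes a :: "'i::{finite,linorder} \<Rightarrow> nat"
  assumes pos: "\<And>i. a i > 0" and fin: "finite (- generated_semigroup (range a))"
    and sym: "symmetric_semigroup (generated_semigroup (range a))"
  shows "component_binomials a \<subseteq> (RF_relations a :: ('i, 'k::field) mvpoly set)"
proof
  fix g :: "('i, 'k) mvpoly"
  assume "g \<in> component_binomials a"
  then obtain m where g: "g = single (base_fact a (weight a m)) 1 - single (component_rep a m) 1"
      "\<not> connected_fact a (base_fact a (weight a m)) m"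
    unfolding component_binomials_def by blast
  let ?u = "base_fact a (weight a m)" and ?v = "component_rep a m"
  obtain f where f: "PF (range (weight a)) = {f}"
    using sym unfolding symmetric_semigroup_def generated_semigroup_range
    by (auto simp: card_1_singleton_iff)
  have uv: "\<not> connected_fact a ?u ?v"
    using g(2) connected_component_rep connected_fact_sym connected_fact_trans by blast
  \<comment> \<open>In weight 0 the only factorization is 0, so \<open>?u\<close> and
    \<open>?v\<close> would coincide. A positive weight supplies an index \<open>j\<close> in
    \<open>?v\<close>.\<close>
  have "weight a m \<noteq> 0"
    using uv weight_eq_0_imp[of a, OF pos] connected_fact.refl
    by (metis weight_base_fact weight_component_rep)
  then have "?v \<noteq> 0"
    by (metis weight_component_rep weight_zero)
  then obtain j where j: "lookup ?v j > 0"
    by (metis gr0I lookup_zero poly_mapping_eqI)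
  then obtain i where i: "i \<le> j" "lookup ?u i > 0"
    using base_fact_least[of a ?v "weight a m" j] by auto
  \<comment> \<open>A common index would make the two factorizations adjacent; so
    \<open>i < j\<close>, the order needed for the sign.\<close>
  moreover have "i \<noteq> j"
    using uv i j connected_fact_adjacent[of a ?u ?v] by auto
  ultimately show "g \<in> RF_relations a"
    unfolding g(1) using pos fin f uv j
    by (intro binomial_is_RF_relation[of a f ?u ?v i j]) (auto simp: generated_semigroup_range)
qed

theorem theorem5p3:
  fixes m\<^sub>0 m\<^sub>1 m\<^sub>2 d n :: nat and a :: "4 \<Rightarrow> nat" and H :: "nat set"
  assumes "m\<^sub>0 \<ge> 1" and "d \<ge> 1" and "n \<ge> 1"
    and "gcd m\<^sub>0 (gcd d n) = 1"
    and "m\<^sub>1 = m\<^sub>0 + d" and "m\<^sub>2 = m\<^sub>0 + 2 * d"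
    and "a 0 = m\<^sub>0" and "a 1 = m\<^sub>1" and "a 2 = m\<^sub>2" and "a 3 = n"
    and "H = generated_semigroup {m\<^sub>0, m\<^sub>1, m\<^sub>2, n}"
    and "minimally_generates a H"
    and "symmetric_semigroup H"
  shows "\<exists>G \<subseteq> RF_relations a.
           minimal_generating_set G (defining_ideal a :: (4, 'k::field) mvpoly set)"
proof -
  have H: "H = generated_semigroup (range a)"
    using assms(12) by (simp add: minimally_generates_def)
  have pos: "a i > 0" for i
    using assms(12) by (rule minimally_generates_pos)
  \<comment> \<open>Since \<open>m\<^sub>1 = m\<^sub>0 + d\<close>, replacing \<open>d\<close> by
    \<open>m\<^sub>1\<close> keeps the gcd. Three coprime elements of \<open>H\<close> then make its
    complement finite, as the reflection argument requires.\<close>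
  have "gcd m\<^sub>0 (gcd m\<^sub>1 n) = gcd (gcd m\<^sub>0 m\<^sub>1) n"
    by (simp add: gcd.assoc)
  also have "\<dots> = gcd (gcd m\<^sub>0 d) n"
    unfolding assms(5) by simp
  finally have "gcd m\<^sub>0 (gcd m\<^sub>1 n) = 1"
    using assms(4) by (simp add: gcd.assoc)
  moreover have "m\<^sub>0 \<in> H" "m\<^sub>1 \<in> H" "n \<in> H" "submonoid_nat H"
    using generated_semigroup_superset[of "{m\<^sub>0, m\<^sub>1, m\<^sub>2, n}"]
    by (simp_all add: assms(11) submonoid_nat_generated)
  ultimately have "finite (- H)"
    by (intro finite_gaps_if_coprime[of H m\<^sub>0 m\<^sub>1 n])
  then have "component_binomials a \<subseteq> (RF_relations a :: (4, 'k) mvpoly set)"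
    using assms(13) pos unfolding H by (intro component_binomials_subset_RF_relations)
  moreover have "minimal_generating_set (component_binomials a) (defining_ideal a :: (4, 'k) mvpoly set)"
    using pos by (rule minimal_generating_set_component_binomials)
  ultimately show ?thesis
    by blast
qed

end
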